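(* As $d$ tends to infinity through the positive integers, $$ \lim_{d\to\infty} d^{1/2}\int_0^\infty\frac{\sin^d x}{x^d}\,dx=\frac{(6\pi)^{1/2}}{2}. $$ *)

theory Defs
  imports "HOL-Analysis.Analysis"
begin

end

theory Submission
  imports Defs "HOL-Probability.Probability" "HOL-Real_Asymp.Real_Asymp"
begin

text \<open>
  The integral is a Laplace integral: for large \<open>d\<close> the power \<open>(sin x / x) ^ d\<close> is concentrated
  at the origin, where \<open>sin x / x\<close> behaves like \<open>exp (- x\<^sup>2 / 6)\<close>. The substitution
  \<open>x = sqrt (6 / d) * t\<close> makes this a statement about pointwise limits. The factor \<open>sqrt d\<close> is
  absorbed, leaving \<open>sqrt 6\<close> times the integral over \<open>t > 0\<close> of
  \<open>(sin x / x) ^ d\<close> with \<open>x = sqrt (6 / d) * t\<close>, and this integrand tends to \<open>exp (- t\<^sup>2)\<close>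
  for every \<open>t > 0\<close> (\<open>sinc_power_tendsto_gaussian\<close>). The Gaussian integral over the half-line
  is \<open>sqrt pi / 2\<close>, so the expected limit is \<open>sqrt 6 * sqrt pi / 2\<close>.

  To exchange limit and integral, one integrable majorant serves the whole half-line, so that the
  oscillating tail needs no separate treatment. The inequality \<open>(sin x / x)\<^sup>2 \<le> 1 / (1 + x\<^sup>2 / 6)\<close>
  holds for all \<open>x > 0\<close> (\<open>sin_squared_bound\<close>). Near \<open>0\<close> it loses a factor two in the
  coefficient of \<open>x\<^sup>2\<close>, which is harmless, and in exchange it holds arbitrarily far out. After the substitution
  it bounds the square of the integrand by \<open>(1 + t\<^sup>2 / d) powr (- d)\<close>, and this decreases in \<open>d\<close>,
  so that \<open>d \<ge> 2\<close> gives the Lorentzian majorant \<open>2 / (1 + t\<^sup>2)\<close>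
  (\<open>scaled_sinc_power_bound\<close>).
\<close>

section \<open>Bounds for powers of the sinc function\<close>

text \<open>
  Up to \<open>x = 2\<close> the Taylor polynomial of degree five gives \<open>sin x \<le> x * (1 - u)\<close> with
  \<open>u = x\<^sup>2 / 12\<close>; since \<open>1 + x\<^sup>2 / 6 = 1 + 2 * u \<le> (1 + u)\<^sup>2\<close>, the left-hand side is at most
  \<open>x\<^sup>2 * (1 - u\<^sup>2)\<^sup>2\<close>. Beyond \<open>2\<close> the trivial bound \<open>\<bar>sin x\<bar> \<le> 1\<close> is enough.
\<close>

lemma sin_squared_bound:
  fixes x :: real
  assumes "x > 0"
  shows "(sin x)\<^sup>2 * (1 + x\<^sup>2 / 6) \<le> x\<^sup>2"
proof (cases "x \<le> 2")
  case True
  then have x2: "x\<^sup>2 \<le> 2\<^sup>2" using assms by (intro power_mono) auto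
  have sin_nonneg: "sin x \<ge> 0"
    using assms True pi_gt3 by (intro sin_ge_zero) auto
  obtain t where "sin x = (\<Sum>m<5. sin_coeff m * x ^ m) + (sin (t + 1/2 * real 5 * pi) / fact 5) * x ^ 5"
    using Maclaurin_sin_expansion by blast
  also have "(\<Sum>m<5. sin_coeff m * x ^ m) = x - x ^ 3 / 6"
    by (simp add: sin_coeff_def lessThan_nat_numeral fact_numeral)
  also have "(sin (t + 1/2 * real 5 * pi) / fact 5) * x ^ 5 \<le> (1 / fact 5) * x ^ 5"
    using assms by (intro mult_right_mono divide_right_mono) auto
  finally have "sin x \<le> x - x ^ 3 / 6 + x ^ 5 / 120"
    by (simp add: fact_numeral)
  also have "x ^ 5 \<le> x ^ 3 * 10"
  proof -
    have "x ^ 3 * x\<^sup>2 \<le> x ^ 3 * 10" using assms x2 by (intro mult_left_mono) auto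
    then show ?thesis by (simp flip: power_add)
  qed
  finally have "sin x \<le> x * (1 - x\<^sup>2 / 12)"
    by (simp add: algebra_simps power3_eq_cube power2_eq_square)
  then have "(sin x)\<^sup>2 \<le> (x * (1 - x\<^sup>2 / 12))\<^sup>2"
    using sin_nonneg by (intro power_mono)
  then have "(sin x)\<^sup>2 * (1 + x\<^sup>2 / 6) \<le> (x * (1 - x\<^sup>2 / 12))\<^sup>2 * (1 + x\<^sup>2 / 12)\<^sup>2"
  proof (rule mult_mono)
    show "1 + x\<^sup>2 / 6 \<le> (1 + x\<^sup>2 / 12)\<^sup>2"
      using zero_le_power2[of "x\<^sup>2 / 12"] by (simp add: power2_sum)
  qed auto
  also have "\<dots> = x\<^sup>2 * (1 - (x\<^sup>2 / 12)\<^sup>2)\<^sup>2"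
    by (simp add: power2_eq_square algebra_simps)
  also have "\<dots> \<le> x\<^sup>2 * 1"
  proof -
    have "(x\<^sup>2 / 12)\<^sup>2 \<le> 1" using x2 by (intro power_le_one) auto
    then show ?thesis by (intro mult_left_mono power_le_one) auto
  qed
  finally show ?thesis by simp
next
  case False
  then have "2\<^sup>2 \<le> x\<^sup>2" by (intro power_mono) auto
  have "(sin x)\<^sup>2 * (1 + x\<^sup>2 / 6) \<le> 1 * (1 + x\<^sup>2 / 6)"
    by (intro mult_right_mono) (auto simp: abs_square_le_1)
  also have "\<dots> \<le> x\<^sup>2" using \<open>2\<^sup>2 \<le> x\<^sup>2\<close> by simp
  finally show ?thesis .
qed

text \<open>
  Bernoulli's inequality alone would only give a majorant of order \<open>1 / t\<close>, which is not
  integrable; the quadratic binomial term supplies the missing decay.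
\<close>

lemma Bernoulli_inequality_quadratic:
  fixes y :: real
  assumes "y \<ge> 0"
  shows "1 + real n * y + real n * (real n - 1) / 2 * y\<^sup>2 \<le> (1 + y) ^ n"
proof (induction n)
  case 0
  show ?case by simp
next
  case (Suc n)
  have "0 \<le> real n * (real n - 1) / 2"
    by (cases n) auto
  then have "0 \<le> real n * (real n - 1) / 2 * y ^ 3"
    using assms by (intro mult_nonneg_nonneg) auto
  then have "1 + real (Suc n) * y + real (Suc n) * (real (Suc n) - 1) / 2 * y\<^sup>2
      \<le> (1 + y) * (1 + real n * y + real n * (real n - 1) / 2 * y\<^sup>2)"
    by (simp add: field_simps power2_eq_square power3_eq_cube)
  also have "\<dots> \<le> (1 + y) * (1 + y) ^ n"
    using assms Suc.IH by (intro mult_left_mono) auto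
  finally show ?case by simp
qed

lemma one_plus_half_squared_le_power:
  fixes s :: real
  assumes "s \<ge> 0" "d \<ge> 2"
  shows "(1 + s / 2)\<^sup>2 \<le> (1 + s / real d) ^ d"
proof -
  have "1 / 2 \<le> (real d - 1) / real d"
    using assms by (simp add: field_simps)
  then have "1 / 2 * (s\<^sup>2 / 2) \<le> (real d - 1) / real d * (s\<^sup>2 / 2)"
    by (intro mult_right_mono) auto
  then have "(1 + s / 2)\<^sup>2 \<le> 1 + s + (real d - 1) / real d * (s\<^sup>2 / 2)"
    by (simp add: power2_eq_square algebra_simps)
  also have "\<dots> = 1 + real d * (s / real d) + real d * (real d - 1) / 2 * (s / real d)\<^sup>2"
    using assms by (simp add: power2_eq_square field_simps)
  also have "\<dots> \<le> (1 + s / real d) ^ d"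
    using assms by (intro Bernoulli_inequality_quadratic) auto
  finally show ?thesis .
qed

lemma scaled_sinc_power_bound:
  fixes t :: real
  assumes "t > 0" "d \<ge> 2"
  defines "x \<equiv> sqrt (6 / real d) * t"
  shows "\<bar>sin x ^ d / x ^ d\<bar> \<le> 2 * inverse (1 + t\<^sup>2)"
proof -
  have x: "x > 0" and x2: "x\<^sup>2 = 6 * (t\<^sup>2 / real d)"
    using assms by (auto simp: power_mult_distrib)
  have "(sin x / x)\<^sup>2 \<le> 1 / (1 + t\<^sup>2 / real d)"
  proof -
    have pos: "0 < 1 + t\<^sup>2 / real d" by (intro add_pos_nonneg) auto
    have "(sin x)\<^sup>2 * (1 + t\<^sup>2 / real d) \<le> x\<^sup>2"
      using sin_squared_bound[OF x] by (simp add: x2)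
    then show ?thesis
      using pos x by (simp add: power_divide pos_divide_le_eq pos_le_divide_eq)
  qed
  then have "((sin x / x)\<^sup>2) ^ d \<le> (1 / (1 + t\<^sup>2 / real d)) ^ d"
    by (intro power_mono) auto
  also have "\<dots> = 1 / (1 + t\<^sup>2 / real d) ^ d"
    by (simp add: power_divide)
  also have "\<dots> \<le> 1 / (1 + t\<^sup>2 / 2)\<^sup>2"
    using assms(2) one_plus_half_squared_le_power[of "t\<^sup>2" d]
    by (intro divide_left_mono mult_pos_pos zero_less_power add_pos_nonneg) auto
  finally have "\<bar>(sin x / x) ^ d\<bar>\<^sup>2 \<le> (1 / (1 + t\<^sup>2 / 2))\<^sup>2"
    by (simp add: power_divide mult.commute flip: power_mult)
  then have "\<bar>(sin x / x) ^ d\<bar> \<le> 1 / (1 + t\<^sup>2 / 2)"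
    by (rule power2_le_imp_le) auto
  also have "\<dots> \<le> 2 * inverse (1 + t\<^sup>2)"
    by (simp add: field_simps add_pos_nonneg)
  finally show ?thesis by (simp add: power_divide)
qed

section \<open>The Gaussian limit of the rescaled powers\<close>

text \<open>
  With \<open>u = sqrt (6 / d) * t\<close> one has \<open>d = 6 * t\<^sup>2 / u\<^sup>2\<close>, so the logarithm of the power is
  \<open>6 * t\<^sup>2\<close> times \<open>ln (sin u / u) / u\<^sup>2\<close>, and the latter tends to \<open>- 1 / 6\<close> as \<open>u\<close>
  tends to \<open>0\<close>.
\<close>

lemma sinc_power_tendsto_gaussian:
  fixes t :: real
  assumes "t > 0"
  shows "(\<lambda>d. sin (sqrt (6 / real d) * t) ^ d / (sqrt (6 / real d) * t) ^ d)
           \<longlonglongrightarrow> exp (- t\<^sup>2)"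
proof -
  define u where "u = (\<lambda>d. sqrt (6 / real d) * t)"
  have u: "filterlim u (at_right 0) sequentially"
    unfolding u_def using assms by real_asymp
  have "((\<lambda>u::real. ln (sin u / u) / u\<^sup>2) \<longlongrightarrow> - 1 / 6) (at_right 0)"
    by real_asymp
  from filterlim_compose[OF this u]
  have "(\<lambda>d. exp (6 * t\<^sup>2 * (ln (sin (u d) / u d) / (u d)\<^sup>2))) \<longlonglongrightarrow> exp (6 * t\<^sup>2 * (- 1 / 6))"
    by (intro tendsto_exp tendsto_mult_left)
  moreover have "\<forall>\<^sub>F d in sequentially.
      exp (6 * t\<^sup>2 * (ln (sin (u d) / u d) / (u d)\<^sup>2)) = sin (u d) ^ d / u d ^ d"
  proof -
    have "\<forall>\<^sub>F u in at_right 0. 0 < u \<and> u < pi"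
      using pi_gt_zero unfolding eventually_at_right_field by blast
    then have "\<forall>\<^sub>F d in sequentially. 0 < u d \<and> u d < pi"
      using u by (rule eventually_compose_filterlim)
    then show ?thesis
      using eventually_gt_at_top[of 0]
    proof eventually_elim
      case (elim d)
      have "6 * t\<^sup>2 = real d * (u d)\<^sup>2"
        using elim by (simp add: u_def power_mult_distrib)
      then have "6 * t\<^sup>2 * (ln (sin (u d) / u d) / (u d)\<^sup>2) = real d * ln (sin (u d) / u d)"
        using elim by simp
      then have "exp (6 * t\<^sup>2 * (ln (sin (u d) / u d) / (u d)\<^sup>2)) = exp (ln (sin (u d) / u d)) ^ d"
        by (simp add: exp_of_nat_mult)
      also have "\<dots> = sin (u d) ^ d / u d ^ d"
        using elim by (simp add: sin_gt_zero power_divide)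
      finally show ?case .
    qed
  qed
  ultimately have "(\<lambda>d. sin (u d) ^ d / u d ^ d) \<longlonglongrightarrow> exp (6 * t\<^sup>2 * (- 1 / 6))"
    by (rule Lim_transform_eventually)
  then show ?thesis by (simp add: u_def)
qed

section \<open>Integrals over the open half-line\<close>

lemma integral_gaussian_Ioi:
  "integral {0<..} (\<lambda>t::real. exp (- t\<^sup>2)) = sqrt pi / 2"
proof -
  have "((\<lambda>t::real. indicator {0..} t *\<^sub>R exp (- t\<^sup>2)) has_integral sqrt pi / 2) UNIV"
    using gaussian_moment_0 has_integral_integral_lborel
    by (metis has_bochner_integral_iff)
  then have "((\<lambda>t::real. exp (- t\<^sup>2)) has_integral sqrt pi / 2) {0..}"
    by (simp add: indicator_def of_bool_def if_distrib[of "\<lambda>c. c * _"]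
        has_integral_restrict_UNIV flip: atLeast_iff cong: if_cong)
  moreover have "((\<lambda>t::real. exp (- t\<^sup>2)) has_integral sqrt pi / 2) {0<..}
      \<longleftrightarrow> ((\<lambda>t::real. exp (- t\<^sup>2)) has_integral sqrt pi / 2) {0..}"
    by (rule has_integral_spike_set_eq; rule negligible_subset[of "{0}"]) auto
  ultimately show ?thesis
    by (metis integral_unique)
qed

lemma integrable_lorentzian_Ioi:
  "(\<lambda>t::real. 2 * inverse (1 + t\<^sup>2)) integrable_on {0<..}"
proof -
  have "set_integrable lborel {0<..} (\<lambda>t::real. inverse (1 + t\<^sup>2))"
    using integrable_inverse_1_plus_square by (rule set_integrable_subset) auto
  then have "(\<lambda>t::real. inverse (1 + t\<^sup>2)) integrable_on {0<..}"
    by (rule set_borel_integral_eq_integral)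
  then show ?thesis
    by (rule integrable_on_mult_right)
qed

lemma integral_Ioi_scale:
  fixes f :: "real \<Rightarrow> real"
  assumes "m > 0" "(\<lambda>t. f (m * t)) absolutely_integrable_on {0<..}"
  shows "integral {0<..} f = m * integral {0<..} (\<lambda>t. f (m * t))"
proof -
  have image: "(\<lambda>t. m * t) ` {0<..} = {0<..}"
  proof (intro equalityI subsetI)
    fix x :: real assume "x \<in> {0<..}"
    then show "x \<in> (\<lambda>t. m * t) ` {0<..}"
      using assms(1) by (intro image_eqI[of _ _ "x / m"]) auto
  qed (use assms(1) in auto)
  have inj: "inj_on (\<lambda>t. m * t) {0<..}"
    using assms(1) by (auto intro!: inj_onI)
  have "(\<lambda>t. \<bar>m\<bar> * f (m * t)) absolutely_integrable_on {0<..}"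
    using assms(2) by (rule set_integrable_mult_right)
  then have "integral ((\<lambda>t. m * t) ` {0<..}) f = integral {0<..} (\<lambda>t. \<bar>m\<bar> * f (m * t))"
    using has_absolute_integral_change_of_variables_1'[of "{0<..}" "\<lambda>t. m * t" "\<lambda>_. m" f, OF _ _ inj]
    by (auto intro!: derivative_eq_intros)
  then show ?thesis
    using assms(1) by (simp add: image)
qed

lemma scaled_sinc_power_absolutely_integrable:
  assumes "d \<ge> 2"
  shows "(\<lambda>t. sin (sqrt (6 / real d) * t) ^ d / (sqrt (6 / real d) * t) ^ d)
           absolutely_integrable_on {0<..}"
proof (rule measurable_bounded_by_integrable_imp_absolutely_integrable)
  show "(\<lambda>t. sin (sqrt (6 / real d) * t) ^ d / (sqrt (6 / real d) * t) ^ d)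
      \<in> borel_measurable (lebesgue_on {0<..})"
    using assms
    by (intro continuous_imp_measurable_on_sets_lebesgue continuous_intros) auto
  show "norm (sin (sqrt (6 / real d) * t) ^ d / (sqrt (6 / real d) * t) ^ d)
      \<le> 2 * inverse (1 + t\<^sup>2)" if "t \<in> {0<..}" for t
    using that assms scaled_sinc_power_bound by simp
qed (use integrable_lorentzian_Ioi in auto)

section \<open>The limit\<close>

theorem theorem3p1:
  shows "(\<lambda>d::nat. sqrt (real d) * integral {0<..} (\<lambda>x::real. sin x ^ d / x ^ d))
           \<longlonglongrightarrow> sqrt (6 * pi) / 2"
proof -
  define f where "f = (\<lambda>d (t::real). sin (sqrt (6 / real d) * t) ^ d / (sqrt (6 / real d) * t) ^ d)"
  \<comment> \<open>The index is shifted because no integrable majorant covers \<open>d = 1\<close>, where the integral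
    converges only conditionally, or \<open>d = 0\<close>, where it diverges.\<close>
  have "(\<lambda>k. integral {0<..} (f (k + 2))) \<longlonglongrightarrow> integral {0<..} (\<lambda>t. exp (- t\<^sup>2))"
  proof (rule dominated_convergence(2)[OF _ integrable_lorentzian_Ioi])
    show "f (k + 2) integrable_on {0<..}" for k
      unfolding f_def
      by (intro set_lebesgue_integral_eq_integral scaled_sinc_power_absolutely_integrable) simp
    show "norm (f (k + 2) t) \<le> 2 * inverse (1 + t\<^sup>2)" if "t \<in> {0<..}" for k t
      using that scaled_sinc_power_bound[of t "k + 2"] by (simp only: f_def real_norm_def) auto
    show "(\<lambda>k. f (k + 2) t) \<longlonglongrightarrow> exp (- t\<^sup>2)" if "t \<in> {0<..}" for t
      using that unfolding f_def
      by (intro LIMSEQ_ignore_initial_segment[OF sinc_power_tendsto_gaussian]) auto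
  qed
  then have "(\<lambda>k. sqrt 6 * integral {0<..} (f (k + 2))) \<longlonglongrightarrow> sqrt 6 * (sqrt pi / 2)"
    unfolding integral_gaussian_Ioi by (intro tendsto_intros)
  moreover have "sqrt 6 * integral {0<..} (f (k + 2))
      = sqrt (real (k + 2)) * integral {0<..} (\<lambda>x::real. sin x ^ (k + 2) / x ^ (k + 2))" for k
  proof -
    have "integral {0<..} (\<lambda>x::real. sin x ^ (k + 2) / x ^ (k + 2))
        = sqrt (6 / real (k + 2)) * integral {0<..} (f (k + 2))"
      unfolding f_def
      by (intro integral_Ioi_scale scaled_sinc_power_absolutely_integrable) auto
    then show ?thesis
      by (simp add: real_sqrt_divide)
  qed
  ultimately have "(\<lambda>k. sqrt (real (k + 2)) *
      integral {0<..} (\<lambda>x::real. sin x ^ (k + 2) / x ^ (k + 2))) \<longlonglongrightarrow> sqrt (6 * pi) / 2"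
    by (simp only: real_sqrt_mult times_divide_eq_right)
  then show ?thesis
    by (rule LIMSEQ_offset)
qed

end
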